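(* Suppose that $\Omega\subseteq\mathbb{R}^2$ and $u:\Omega\to\mathbb{R}^2$ is an $\infty$-Harmonic map in $C^2(\Omega)^2$. Then, for all $\Omega'\Subset\Omega$, the image $u(\Omega')$ is contained in the closed convex hull of the boundary values: $$u(\Omega')\subseteq\overline{\mathrm{co}}\big(u(\partial\Omega')\big).$$
   Context: $\Omega$ is an open subset of $\mathbb{R}^2$. $\Omega'\Subset\Omega$ means that the closure of $\Omega'$ is a compact subset of $\Omega$. $\overline{\mathrm{co}}$ denotes the closed convex hull. For $u=(u_1,\dots,u_N):\Omega\subseteq\mathbb{R}^n\to\mathbb{R}^N$ (here $n=N=2$) the gradient $Du=(D_iu_\alpha)$ is viewed as an $N\times n$ matrix, with Euclidean norm $|Du|=(D_iu_\alpha D_iu_\alpha)^{1/2}$ (summation over repeated indices; Greek indices from $1$ to $N$, Latin from $1$ to $n$). $[Du]^\perp$ is the orthogonal projection of $\mathbb{R}^N$ onto the nullspace of $(Du)^\top:\mathbb{R}^N\to\mathbb{R}^n$. An $\infty$-Harmonic map is a classical ($C^2$) solution of the $\infty$-Laplacian system $\Delta_\infty u=0$, i.e. $$D_iu_\alpha\,D_ju_\beta\,D^2_{ij}u_\beta+|Du|^2[Du]^\perp_{\alpha\beta}D^2_{ii}u_\beta=0,\qquad \alpha=1,\dots,N.$$ *)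

theory Defs
  imports "HOL-Analysis.Analysis"
begin

definition pderiv_i :: "'n \<Rightarrow> (real ^ 'n \<Rightarrow> 'b::real_normed_vector) \<Rightarrow> real ^ 'n::finite \<Rightarrow> 'b"
  where "pderiv_i i f x = frechet_derivative f (at x) (axis i 1)"

text \<open>The library's Jacobian is the gradient matrix: rows are indexed by the components
  of the map, columns by the coordinates of the domain.\<close>

lemma jacobian_nth:
  fixes u :: "real ^ 'n \<Rightarrow> real ^ 'm"
  shows "jacobian u (at x) $ \<alpha> $ i = pderiv_i i u x $ \<alpha>"
  by (simp add: jacobian_def matrix_def pderiv_i_def)

text \<open>The norm of the type of matrices is the Euclidean (Frobenius) norm.\<close>

lemma norm_matrix_power2:
  fixes A :: "real ^ 'n ^ 'm"
  shows "(norm A)\<^sup>2 = (\<Sum>\<alpha>\<in>UNIV. \<Sum>i\<in>UNIV. (A $ \<alpha> $ i)\<^sup>2)"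
  by (simp add: norm_vec_def L2_set_def sum_nonneg)

text \<open>The two notions below are meant for open sets, where the derivatives at a point
  depend only on the values of the map in the set.\<close>

definition C1_on :: "(real ^ 'n::finite) set \<Rightarrow> (real ^ 'n \<Rightarrow> 'b::real_normed_vector) \<Rightarrow> bool"
  where "C1_on S f \<longleftrightarrow>
    (\<forall>x\<in>S. f differentiable (at x)) \<and> (\<forall>i. continuous_on S (pderiv_i i f))"

definition C2_on :: "(real ^ 'n::finite) set \<Rightarrow> (real ^ 'n \<Rightarrow> 'b::real_normed_vector) \<Rightarrow> bool"
  where "C2_on S f \<longleftrightarrow> C1_on S f \<and> (\<forall>i. C1_on S (pderiv_i i f))"

definition orth_proj :: "'a::euclidean_space set \<Rightarrow> 'a \<Rightarrow> 'a"
  where "orth_proj S v = (THE p. p \<in> S \<and> (\<forall>w\<in>S. orthogonal (v - p) w))"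

lemma orth_proj_ex1:
  fixes S :: "'a::euclidean_space set"
  assumes "subspace S"
  shows "\<exists>!p. p \<in> S \<and> (\<forall>w\<in>S. orthogonal (v - p) w)"
proof -
  have span: "span S = S" using assms by simp
  obtain y z where y: "y \<in> S" and z: "\<And>w. w \<in> S \<Longrightarrow> orthogonal z w" and v: "v = y + z"
    using orthogonal_subspace_decomp_exists[of S v] unfolding span by metis
  show ?thesis
  proof (rule ex1I[of _ y])
    show "y \<in> S \<and> (\<forall>w\<in>S. orthogonal (v - y) w)"
      using y z v by simp
    fix p assume p: "p \<in> S \<and> (\<forall>w\<in>S. orthogonal (v - p) w)"
    have d: "y - p \<in> S" using assms y p by (simp add: subspace_diff)
    have "orthogonal (v - p) (y - p)" "orthogonal z (y - p)" using p z d by blast+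
    then have "orthogonal (y - p) (y - p)"
      unfolding v orthogonal_def by (simp add: algebra_simps)
    then show "p = y" by (simp add: orthogonal_self)
  qed
qed

definition perp_matrix :: "real ^ 'n ^ 'm \<Rightarrow> real ^ 'm ^ 'm"
  where "perp_matrix A = matrix (orth_proj {v. transpose A *v v = 0})"

definition infinity_laplacian :: "(real ^ 'n \<Rightarrow> real ^ 'm) \<Rightarrow> real ^ 'n \<Rightarrow> real ^ 'm"
  where "infinity_laplacian u x = (\<chi> \<alpha>.
    (\<Sum>i\<in>UNIV. \<Sum>j\<in>UNIV. \<Sum>\<beta>\<in>UNIV.
       pderiv_i i u x $ \<alpha> * pderiv_i j u x $ \<beta> * pderiv_i i (pderiv_i j u) x $ \<beta>)
    + (norm (jacobian u (at x)))\<^sup>2 *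
      (\<Sum>\<beta>\<in>UNIV. \<Sum>i\<in>UNIV.
         perp_matrix (jacobian u (at x)) $ \<alpha> $ \<beta> * pderiv_i i (pderiv_i i u) x $ \<beta>))"

definition infinity_harmonic_on :: "(real ^ 'n) set \<Rightarrow> (real ^ 'n \<Rightarrow> real ^ 'm) \<Rightarrow> bool"
  where "infinity_harmonic_on \<Omega> u \<longleftrightarrow> C2_on \<Omega> u \<and> (\<forall>x\<in>\<Omega>. infinity_laplacian u x = 0)"

end

theory Submission
  imports Defs
begin

text \<open>Let \<open>\<phi> = |u - a|\<^sup>2\<close> and \<open>g = |Du|\<^sup>2\<close>. The tangential part of the system says \<open>Du Dg = 0\<close>, hence
  \<open>Dg \<bullet> D\<phi> = 0\<close>: \<open>g\<close> is constant along the gradient flow of \<open>\<phi>\<close>. At a critical point of \<open>\<phi>\<close> with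
  \<open>g > 0\<close> the vector \<open>u - a\<close> lies in the nullspace of the transpose of \<open>Du\<close>, so the normal part
  gives \<open>\<Delta>\<phi> = 2 g > 0\<close>: the flow expands volume there. If \<open>{\<phi> \<ge> m}\<close> is compact inside the open set,
  this cannot happen, as the field \<open>\<chi>(\<phi>) \<psi>(g) D\<phi>\<close>, with cutoffs vanishing for \<open>\<phi> \<le> m\<close> and
  \<open>g \<le> c\<close>, has divergence at least \<open>\<chi>(\<phi>) \<psi>(g) (C |D\<phi>|\<^sup>2 + \<Delta>\<phi>)\<close> when \<open>\<chi>' \<ge> C \<chi>\<close>. For large \<open>C\<close> this
  is nonnegative, and its integral is \<open>0\<close>. Hence \<open>Du = 0\<close> on \<open>{\<phi> > m}\<close>, so \<open>\<phi>\<close> is locally constant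
  there, which forces \<open>{\<phi> > m}\<close> to be empty. A value of \<open>u\<close> outside the closed convex hull of the
  boundary values would be cut off from them by a large sphere around some \<open>a\<close>.\<close>

section \<open>Directional derivatives and the integral of a compactly supported divergence\<close>

lemma has_derivative_along_line_shift:
  fixes f f' :: "'a::real_normed_vector \<Rightarrow> real"
  assumes "\<And>x. ((\<lambda>t. f (x + t *\<^sub>R e)) has_real_derivative f' x) (at 0)"
  shows "((\<lambda>t. f (x + t *\<^sub>R e)) has_real_derivative f' (x + s *\<^sub>R e)) (at s)"
proof -
  have "((\<lambda>t. f ((x + s *\<^sub>R e) + t *\<^sub>R e)) has_real_derivative f' (x + s *\<^sub>R e)) (at 0)"
    by (rule assms)
  also have "(\<lambda>t. f ((x + s *\<^sub>R e) + t *\<^sub>R e)) = (\<lambda>t. f (x + (t + s) *\<^sub>R e))"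
    by (simp add: algebra_simps)
  finally show ?thesis
    using DERIV_shift[of "\<lambda>t. f (x + t *\<^sub>R e)" "f' (x + s *\<^sub>R e)" 0 s] by simp
qed

lemma has_derivative_along_line_local:
  fixes f h :: "'a::real_normed_vector \<Rightarrow> 'b::real_normed_vector"
  assumes "((\<lambda>t. f (x + t *\<^sub>R e)) has_vector_derivative D) (at 0)"
    and "open T" "x \<in> T" "\<And>y. y \<in> T \<Longrightarrow> f y = h y"
  shows "((\<lambda>t. h (x + t *\<^sub>R e)) has_vector_derivative D) (at 0)"
proof -
  have "open ((\<lambda>t. x + t *\<^sub>R e) -` T)"
    by (intro continuous_open_vimage assms) (intro continuous_intros)
  from has_vector_derivative_transform_within_open[OF assms(1) this, of "\<lambda>t. h (x + t *\<^sub>R e)"]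
  show ?thesis using assms(3,4) by simp
qed

text \<open>The open sets \<open>G\<close> and \<open>- K\<close> cover the space, and the extension
  vanishes identically on the second. This turns fields that live on \<open>G\<close> only into
  global ones that can be integrated.\<close>

lemma extend_by_zero_continuous:
  fixes f :: "'a::topological_space \<Rightarrow> 'b::real_normed_vector"
  assumes "open G" "closed K" "K \<subseteq> G" "continuous_on G f" "\<And>x. x \<in> G \<Longrightarrow> x \<notin> K \<Longrightarrow> f x = 0"
  shows "continuous_on UNIV (\<lambda>x. if x \<in> G then f x else 0)"
proof -
  have "continuous_on G (\<lambda>x. if x \<in> G then f x else 0)"
    using assms(4) by (rule continuous_on_eq) simp
  moreover have "continuous_on (- K) (\<lambda>x. if x \<in> G then f x else 0)"
    by (rule continuous_on_eq[of _ "\<lambda>_. 0"]) (use assms(5) in auto)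
  moreover have "G \<union> - K = UNIV" using assms(3) by auto
  ultimately show ?thesis
    using continuous_on_open_Un[of G "- K"] assms(1,2) by (metis open_Compl)
qed

lemma extend_by_zero_derivative_along_line:
  fixes f f' :: "'a::real_normed_vector \<Rightarrow> real"
  assumes "open G" "closed K" "K \<subseteq> G"
    and zero: "\<And>x. x \<in> G \<Longrightarrow> x \<notin> K \<Longrightarrow> f x = 0"
    and deriv: "\<And>x. x \<in> G \<Longrightarrow> ((\<lambda>t. f (x + t *\<^sub>R e)) has_real_derivative f' x) (at 0)"
  shows "((\<lambda>t. if x + t *\<^sub>R e \<in> G then f (x + t *\<^sub>R e) else 0)
           has_real_derivative (if x \<in> G then f' x else 0)) (at 0)"
proof (cases "x \<in> G")
  case True
  then show ?thesis
    using has_derivative_along_line_local[of f x e "f' x" G "\<lambda>x. if x \<in> G then f x else 0"]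
      deriv[OF True] assms(1)
    by (simp add: has_real_derivative_iff_has_vector_derivative)
next
  case False
  have "((\<lambda>t. (\<lambda>x. if x \<in> G then f x else 0) (x + t *\<^sub>R e)) has_vector_derivative 0) (at 0)"
    by (rule has_derivative_along_line_local[where f = "\<lambda>_. 0" and T = "- K"])
       (use False zero assms(2,3) in auto)
  then show ?thesis
    using False by (simp add: has_real_derivative_iff_has_vector_derivative)
qed

text \<open>By translation invariance of Lebesgue measure every difference quotient of
  \<open>f\<close> in direction \<open>e\<close> has integral 0. The mean value theorem bounds the
  quotients by a multiple of the indicator of a fixed ball, so dominated convergence passes to the
  limit \<open>f'\<close>.\<close>

lemma integral_derivative_along_line_zero:
  fixes f f' :: "'a::euclidean_space \<Rightarrow> real"
  assumes contf: "continuous_on UNIV f" and contf': "continuous_on UNIV f'"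
    and deriv: "\<And>x. ((\<lambda>t. f (x + t *\<^sub>R e)) has_real_derivative f' x) (at 0)"
    and "compact K" and zero: "\<And>x. x \<notin> K \<Longrightarrow> f x = 0" and zero': "\<And>x. x \<notin> K \<Longrightarrow> f' x = 0"
  shows "integrable lborel f'" "integral\<^sup>L lborel f' = 0"
proof -
  obtain R where R: "\<And>x. x \<in> K \<Longrightarrow> norm x \<le> R"
    using compact_imp_bounded[OF \<open>compact K\<close>] unfolding bounded_iff by blast
  have "compact (f' ` K)"
    using contf' \<open>compact K\<close> by (intro compact_continuous_image) (auto intro: continuous_on_subset)
  from compact_imp_bounded[OF this] obtain B0 where B0: "\<And>x. x \<in> K \<Longrightarrow> \<bar>f' x\<bar> \<le> B0"
    unfolding bounded_iff by auto
  \<comment> \<open>The maximum keeps \<open>B\<close> nonnegative even if \<open>K\<close> is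
    empty, when \<open>B0\<close> is arbitrary.\<close>
  define B where "B = max 0 B0"
  have B: "\<bar>f' x\<bar> \<le> B" for x
    using B0[of x] zero'[of x] unfolding B_def by (cases "x \<in> K") auto
  have "B \<ge> 0" unfolding B_def by simp
  define h where "h n = 1 / (real n + 1)" for n
  have hpos: "h n > 0" "h n \<le> 1" for n unfolding h_def by (auto simp: field_simps)
  define q where "q n x = (f (x + h n *\<^sub>R e) - f x) / h n" for n x
  \<comment> \<open>Steps have length at most \<open>norm e\<close>, so outside this ball both
    \<open>x\<close> and \<open>x + h n *\<^sub>R e\<close> miss \<open>K\<close> and the quotient
    is 0.\<close>
  define w where "w x = B * indicator (cball 0 (R + norm e)) x" for x :: 'a
  have intf: "integrable lborel f"
  proof -
    have "integrable lborel (\<lambda>x. indicator K x *\<^sub>R f x)"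
      using borel_integrable_compact[OF \<open>compact K\<close>, of f] contf continuous_on_subset
      by (metis subset_UNIV)
    then show ?thesis
      by (rule Bochner_Integration.integrable_cong[THEN iffD1, rotated -1])
         (auto simp: indicator_def zero)
  qed
  have trans: "integrable lborel (\<lambda>x. f (x + c))"
     "integral\<^sup>L lborel (\<lambda>x. f (x + c)) = integral\<^sup>L lborel f" for c
  proof -
    have m: "(\<lambda>x. c + x) \<in> measurable lborel borel" by simp
    have fm: "f \<in> borel_measurable borel" using contf by (rule borel_measurable_continuous_onI)
    have "integrable (distr lborel borel ((+) c)) f"
      using intf by (simp add: lborel_distr_plus)
    then show "integrable lborel (\<lambda>x. f (x + c))"
      using integrable_distr_eq[OF m fm] by (simp add: add.commute)
    show "integral\<^sup>L lborel (\<lambda>x. f (x + c)) = integral\<^sup>L lborel f"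
      using integral_distr[OF m fm] unfolding lborel_distr_plus by (simp add: add.commute)
  qed
  have intq: "integral\<^sup>L lborel (q n) = 0" for n
    unfolding q_def using trans intf by simp
  have bound: "norm (q n x) \<le> w x" for n x
  proof (cases "norm x \<le> R + norm e")
    case True
    obtain z where "f (x + h n *\<^sub>R e) - f (x + 0 *\<^sub>R e) = (h n - 0) * f' (x + z *\<^sub>R e)"
      using MVT2[OF hpos(1)[of n], of "\<lambda>t. f (x + t *\<^sub>R e)" "\<lambda>t. f' (x + t *\<^sub>R e)"]
        has_derivative_along_line_shift[of f e f', OF deriv] by metis
    then have "q n x = f' (x + z *\<^sub>R e)"
      using hpos(1)[of n] unfolding q_def by simp
    then show ?thesis using B True by (simp add: w_def)
  next
    case False
    have "norm x \<le> norm (x + h n *\<^sub>R e) + norm (h n *\<^sub>R e)"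
      using norm_triangle_ineq4[of "x + h n *\<^sub>R e" "h n *\<^sub>R e"] by simp
    moreover have "norm (h n *\<^sub>R e) \<le> norm e"
      using hpos[of n] by (simp add: mult_left_le_one_le)
    ultimately have "x \<notin> K" "x + h n *\<^sub>R e \<notin> K"
      using False R[of x] R[of "x + h n *\<^sub>R e"] norm_ge_zero[of e] by force+
    then show ?thesis using \<open>B \<ge> 0\<close> by (simp add: q_def zero w_def)
  qed
  have "h \<longlonglongrightarrow> 0"
    unfolding h_def using LIMSEQ_inverse_real_of_nat by (simp add: inverse_eq_divide add.commute)
  then have hlim: "filterlim h (at 0) sequentially"
    using hpos(1) by (auto simp: filterlim_at intro!: always_eventually) (metis less_irrefl)
  have lim: "(\<lambda>n. q n x) \<longlonglongrightarrow> f' x" for x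
  proof -
    have "((\<lambda>t. (f (x + t *\<^sub>R e) - f x) / t) \<longlongrightarrow> f' x) (at 0)"
      using deriv[of x] by (simp add: DERIV_def)
    from filterlim_compose[OF this hlim] show ?thesis unfolding q_def .
  qed
  have wint: "integrable lborel w"
    unfolding w_def by (intro integrable_mult_right integrable_real_indicator emeasure_lborel_cball_finite) auto
  have qm: "q n \<in> borel_measurable lborel" for n
    unfolding q_def using trans intf by (intro borel_measurable_integrable) auto
  have f'm: "f' \<in> borel_measurable lborel"
    using borel_measurable_continuous_onI[OF contf'] by simp
  show "integrable lborel f'"
    by (rule integrable_dominated_convergence[where s = q, OF f'm qm wint]) (use lim bound in auto)
  have "(\<lambda>n. integral\<^sup>L lborel (q n)) \<longlonglongrightarrow> integral\<^sup>L lborel f'"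
    by (rule integral_dominated_convergence[where s = q, OF f'm qm wint]) (use lim bound in auto)
  then show "integral\<^sup>L lborel f' = 0"
    by (simp add: intq LIMSEQ_const_iff)
qed

text \<open>Each summand, extended by zero, has integral 0, so the nonnegative divergence vanishes
  almost everywhere. By continuity the set where it is nonzero is open; being null, it is
  empty.\<close>

lemma divergence_nonneg_compact_support_imp_zero:
  fixes X Y :: "'i::finite \<Rightarrow> 'a::euclidean_space \<Rightarrow> real" and e :: "'i \<Rightarrow> 'a"
  assumes "open G" "compact K" "K \<subseteq> G"
    and contX: "\<And>i. continuous_on G (X i)" and contY: "\<And>i. continuous_on G (Y i)"
    and deriv: "\<And>i x. x \<in> G \<Longrightarrow> ((\<lambda>t. X i (x + t *\<^sub>R e i)) has_real_derivative Y i x) (at 0)"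
    and zeroX: "\<And>i x. x \<in> G \<Longrightarrow> x \<notin> K \<Longrightarrow> X i x = 0"
    and zeroY: "\<And>i x. x \<in> G \<Longrightarrow> x \<notin> K \<Longrightarrow> Y i x = 0"
    and nonneg: "\<And>x. x \<in> G \<Longrightarrow> 0 \<le> (\<Sum>i\<in>UNIV. Y i x)"
    and "x \<in> G"
  shows "(\<Sum>i\<in>UNIV. Y i x) = 0"
proof -
  define Z where "Z i x = (if x \<in> G then Y i x else 0)" for i x
  have "closed K" using \<open>compact K\<close> by (rule compact_imp_closed)
  have contZ: "continuous_on UNIV (Z i)" for i
    unfolding Z_def
    by (rule extend_by_zero_continuous[OF \<open>open G\<close> \<open>closed K\<close> \<open>K \<subseteq> G\<close> contY zeroY])
  have "integrable lborel (Z i) \<and> integral\<^sup>L lborel (Z i) = 0" for i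
  proof -
    have c: "continuous_on UNIV (\<lambda>x. if x \<in> G then X i x else 0)"
      by (rule extend_by_zero_continuous[OF \<open>open G\<close> \<open>closed K\<close> \<open>K \<subseteq> G\<close> contX zeroX])
    have d: "((\<lambda>t. if x + t *\<^sub>R e i \<in> G then X i (x + t *\<^sub>R e i) else 0)
           has_real_derivative Z i x) (at 0)" for x
      unfolding Z_def
      by (rule extend_by_zero_derivative_along_line[OF \<open>open G\<close> \<open>closed K\<close> \<open>K \<subseteq> G\<close> zeroX deriv])
    have "(if x \<in> G then X i x else 0) = 0" "Z i x = 0" if "x \<notin> K" for x
      using zeroX[of x] zeroY[of x] that by (auto simp: Z_def)
    then show ?thesis
      using integral_derivative_along_line_zero[OF c contZ d \<open>compact K\<close>] by blast
  qed
  then have int: "integrable lborel (\<lambda>x. \<Sum>i\<in>UNIV. Z i x)"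
    and int0: "integral\<^sup>L lborel (\<lambda>x. \<Sum>i\<in>UNIV. Z i x) = 0"
    by auto
  have nonnegZ: "0 \<le> (\<Sum>i\<in>UNIV. Z i x)" for x
    using nonneg[of x] by (cases "x \<in> G") (auto simp: Z_def)
  have "AE x in lborel. (\<Sum>i\<in>UNIV. Z i x) = 0"
    using integral_nonneg_eq_0_iff_AE[OF int] nonnegZ int0 by auto
  moreover have "continuous_on UNIV (\<lambda>x. \<Sum>i\<in>UNIV. Z i x)"
    using contZ by (intro continuous_on_sum) auto
  then have op: "open {x. (\<Sum>i\<in>UNIV. Z i x) \<noteq> 0}"
    by (intro open_Collect_neq) auto
  ultimately have "{x. (\<Sum>i\<in>UNIV. Z i x) \<noteq> 0} \<in> null_sets lborel"
    by (subst (asm) AE_iff_null) auto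
  then have "negligible {x. (\<Sum>i\<in>UNIV. Z i x) \<noteq> 0}"
    using negligible_iff_null_sets null_sets_completionI by blast
  then have "{x. (\<Sum>i\<in>UNIV. Z i x) \<noteq> 0} = {}"
    using op open_not_negligible by blast
  then have "(\<Sum>i\<in>UNIV. Z i x) = 0" by blast
  then show ?thesis using \<open>x \<in> G\<close> by (simp add: Z_def)
qed

text \<open>Where \<open>L\<close> is positive any \<open>C \<ge> 0\<close> will do. The rest of
  \<open>Q\<close> is compact and free of zeros of \<open>N\<close>, so \<open>N\<close> has a
  positive minimum there and a large \<open>C\<close> outweighs the lower bound of
  \<open>L\<close>.\<close>

lemma ex_dominating_multiple:
  fixes N L :: "'a::topological_space \<Rightarrow> real"
  assumes "compact Q" "continuous_on Q N" "continuous_on Q L"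
    and "\<And>x. x \<in> Q \<Longrightarrow> 0 \<le> N x" and pos: "\<And>x. x \<in> Q \<Longrightarrow> N x = 0 \<Longrightarrow> 0 < L x"
  shows "\<exists>C\<ge>0. \<forall>x\<in>Q. 0 < C * N x + L x"
proof (cases "Q = {}")
  case False
  obtain l where l: "\<And>x. x \<in> Q \<Longrightarrow> l \<le> L x"
    using continuous_attains_inf[OF assms(1) False assms(3)] by auto
  define Q' where "Q' = Q \<inter> L -` {..0}"
  have "compact Q'"
  proof -
    have "closedin (top_of_set Q) Q'"
      unfolding Q'_def by (rule continuous_closedin_preimage[OF assms(3)]) simp
    then show ?thesis using assms(1) closedin_compact by blast
  qed
  show ?thesis
  proof (cases "Q' = {}")
    case True
    then show ?thesis by (intro exI[of _ 0]) (auto simp: Q'_def not_le[symmetric])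
  next
    case False
    have "continuous_on Q' N" by (rule continuous_on_subset[OF assms(2)]) (auto simp: Q'_def)
    from continuous_attains_inf[OF \<open>compact Q'\<close> False this]
    obtain z where z: "z \<in> Q'" "\<And>x. x \<in> Q' \<Longrightarrow> N z \<le> N x" by auto
    have nz: "N z > 0" using z(1) pos[of z] assms(4)[of z] by (force simp: Q'_def)
    \<comment> \<open>With this choice \<open>C * N x\<close> is at least
      \<open>1 + \<bar>l\<bar>\<close> on \<open>Q'\<close>, which exceeds
      \<open>- L x\<close>.\<close>
    define C where "C = (1 + \<bar>l\<bar>) / N z"
    have C: "C \<ge> 0" unfolding C_def using nz by simp
    have "0 < C * N x + L x" if "x \<in> Q" for x
    proof (cases "x \<in> Q'")
      case True
      have "1 + \<bar>l\<bar> = C * N z" unfolding C_def using nz by simp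
      also have "\<dots> \<le> C * N x" using z(2)[OF True] C by (rule mult_left_mono)
      finally show ?thesis using l[OF that] by linarith
    next
      case False
      then have "L x > 0" using that by (auto simp: Q'_def)
      then show ?thesis using C assms(4)[OF that] by (simp add: add_nonneg_pos)
    qed
    then show ?thesis using C by blast
  qed
qed auto

section \<open>Orthogonal projections and the splitting of the system\<close>

lemma orth_proj_in_and_orthogonal:
  fixes S :: "'a::euclidean_space set"
  assumes "subspace S"
  shows "orth_proj S v \<in> S" "\<And>w. w \<in> S \<Longrightarrow> orthogonal (v - orth_proj S v) w"
  using theI'[OF orth_proj_ex1[OF assms, of v]] unfolding orth_proj_def by auto

lemma orth_proj_unique:
  fixes S :: "'a::euclidean_space set"
  assumes "subspace S" "p \<in> S" "\<And>w. w \<in> S \<Longrightarrow> orthogonal (v - p) w"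
  shows "orth_proj S v = p"
  using orth_proj_ex1[OF assms(1), of v] orth_proj_in_and_orthogonal[OF assms(1)] assms(2,3)
  by blast

text \<open>Linearity is what makes the matrix in \<open>perp_matrix\<close> act as the projection
  itself. It follows from the uniqueness of the projection.\<close>

lemma linear_orth_proj:
  fixes S :: "'a::euclidean_space set"
  assumes "subspace S"
  shows "linear (orth_proj S)"
proof (rule linearI)
  note P = orth_proj_in_and_orthogonal[OF assms]
  show "orth_proj S (v + w) = orth_proj S v + orth_proj S w" for v w
  proof (rule orth_proj_unique[OF assms])
    show "orth_proj S v + orth_proj S w \<in> S" using P(1) assms by (simp add: subspace_add)
    show "orthogonal (v + w - (orth_proj S v + orth_proj S w)) z" if "z \<in> S" for z
      using P(2)[OF that, of v] P(2)[OF that, of w] by (simp add: orthogonal_def algebra_simps)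
  qed
  show "orth_proj S (c *\<^sub>R v) = c *\<^sub>R orth_proj S v" for c v
  proof (rule orth_proj_unique[OF assms])
    show "c *\<^sub>R orth_proj S v \<in> S" using P(1) assms by (simp add: subspace_scale)
    show "orthogonal (c *\<^sub>R v - c *\<^sub>R orth_proj S v) z" if "z \<in> S" for z
      using P(2)[OF that, of v] by (simp add: orthogonal_def inner_diff_left)
  qed
qed

lemma norm_jacobian_power2:
  fixes u :: "real ^ 'n::finite \<Rightarrow> real ^ 'm::finite"
  shows "(norm (jacobian u (at x)))\<^sup>2 = (\<Sum>j\<in>UNIV. pderiv_i j u x \<bullet> pderiv_i j u x)"
  unfolding norm_matrix_power2 jacobian_nth
  by (subst sum.swap) (simp add: inner_vec_def power2_eq_square)

text \<open>The first summand of the system lies in the range of the gradient matrix and the second one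
  in its orthogonal complement, so both vanish separately.\<close>

lemma
  fixes u :: "real ^ 'n::finite \<Rightarrow> real ^ 'm::finite"
  assumes "infinity_laplacian u x = 0"
  shows infinity_laplacian_zero_tangential: "(\<Sum>i\<in>UNIV. (\<Sum>j\<in>UNIV. pderiv_i j u x \<bullet> pderiv_i i (pderiv_i j u) x)
            *\<^sub>R pderiv_i i u x) = 0"
    and infinity_laplacian_zero_normal: "\<And>v. jacobian u (at x) \<noteq> 0 \<Longrightarrow> (\<And>i. v \<bullet> pderiv_i i u x = 0) \<Longrightarrow>
            v \<bullet> (\<Sum>i\<in>UNIV. pderiv_i i (pderiv_i i u) x) = 0"
proof -
  define A where "A = jacobian u (at x)"
  define W where "W = {v. transpose A *v v = 0}"
  define T where "T = (\<Sum>i\<in>UNIV. (\<Sum>j\<in>UNIV. pderiv_i j u x \<bullet> pderiv_i i (pderiv_i j u) x)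
            *\<^sub>R pderiv_i i u x)"
  define D where "D = (\<Sum>i\<in>UNIV. pderiv_i i (pderiv_i i u) x)"
  have subW: "subspace W"
    unfolding W_def
    by (auto simp: subspace_def matrix_vector_right_distrib matrix_vector_mult_scaleR
        simp del: transpose_matrix_vector)
  note P = orth_proj_in_and_orthogonal[OF subW]
  have W: "v \<in> W \<longleftrightarrow> (\<forall>i. v \<bullet> pderiv_i i u x = 0)" for v
    by (simp add: W_def A_def vec_eq_iff matrix_vector_mult_def transpose_def jacobian_nth
        inner_vec_def mult.commute)
  have perp: "perp_matrix A *v v = orth_proj W v" for v
    unfolding perp_matrix_def W_def[symmetric] using linear_orth_proj[OF subW] by simp
  have "infinity_laplacian u x = T + (norm A)\<^sup>2 *\<^sub>R (perp_matrix A *v D)"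
  proof -
    have "(\<Sum>\<beta>\<in>UNIV. \<Sum>i\<in>UNIV. perp_matrix A $ \<alpha> $ \<beta> * pderiv_i i (pderiv_i i u) x $ \<beta>)
        = (perp_matrix A *v D) $ \<alpha>" for \<alpha>
      by (simp add: D_def matrix_vector_mult_def sum_distrib_left)
    moreover have "(\<Sum>i\<in>UNIV. \<Sum>j\<in>UNIV. \<Sum>\<beta>\<in>UNIV.
       pderiv_i i u x $ \<alpha> * pderiv_i j u x $ \<beta> * pderiv_i i (pderiv_i j u) x $ \<beta>) = T $ \<alpha>" for \<alpha>
      by (simp add: T_def inner_vec_def sum_distrib_left sum_distrib_right mult_ac)
    ultimately show ?thesis
      unfolding infinity_laplacian_def A_def[symmetric] by (simp add: vec_eq_iff)
  qed
  then have eq: "T + (norm A)\<^sup>2 *\<^sub>R orth_proj W D = 0"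
    using assms perp by simp
  have TW: "w \<bullet> T = 0" if "w \<in> W" for w
    using that unfolding W T_def by (simp add: inner_sum_right)
  have "w \<bullet> ((norm A)\<^sup>2 *\<^sub>R orth_proj W D) = 0" if "w \<in> W" for w
    using arg_cong[OF eq, of "\<lambda>z. w \<bullet> z"] TW[OF that] by (simp add: inner_add_right)
  \<comment> \<open>The scaled projection lies in \<open>W\<close>, so it may be paired with
    itself.\<close>
  then have nA: "(norm A)\<^sup>2 *\<^sub>R orth_proj W D = 0"
    using subspace_scale[OF subW P(1)] inner_eq_zero_iff by blast
  have "T = 0" using eq unfolding nA by simp
  then show "(\<Sum>i\<in>UNIV. (\<Sum>j\<in>UNIV. pderiv_i j u x \<bullet> pderiv_i i (pderiv_i j u) x)
            *\<^sub>R pderiv_i i u x) = 0"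
    unfolding T_def .
  fix v
  assume "jacobian u (at x) \<noteq> 0" and "\<And>i. v \<bullet> pderiv_i i u x = 0"
  then have "orth_proj W D = 0" "v \<in> W" using nA W by (auto simp: A_def)
  then have "v \<bullet> D = 0" using P(2)[of v D] by (simp add: orthogonal_def inner_commute)
  then show "v \<bullet> (\<Sum>i\<in>UNIV. pderiv_i i (pderiv_i i u) x) = 0"
    unfolding D_def .
qed

section \<open>Derivatives along the axes, the cutoff function and a separating sphere\<close>

lemma C1_on_imp_derivative_along_axis:
  assumes "C1_on S f" "x \<in> S"
  shows "((\<lambda>t. f (x + t *\<^sub>R axis i 1)) has_vector_derivative pderiv_i i f x) (at 0)"
proof -
  have f: "(f has_derivative frechet_derivative f (at x)) (at x)"
    using assms unfolding C1_on_def by (simp add: frechet_derivative_works)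
  have l: "((\<lambda>t. x + t *\<^sub>R axis i 1) has_derivative (\<lambda>t. t *\<^sub>R axis i 1)) (at 0)"
    by (auto intro!: derivative_eq_intros)
  have "((\<lambda>t. f (x + t *\<^sub>R axis i 1)) has_derivative
      (\<lambda>t. frechet_derivative f (at x) (t *\<^sub>R axis i 1))) (at 0)"
    using has_derivative_compose[OF l, of f "frechet_derivative f (at x)"] f by simp
  then show ?thesis
    using linear_cmul[OF has_derivative_linear[OF f]]
    by (simp add: has_vector_derivative_def pderiv_i_def)
qed

lemma C1_on_imp_continuous_on: "C1_on S f \<Longrightarrow> continuous_on S f"
  unfolding C1_on_def
  by (meson continuous_at_imp_continuous_on differentiable_imp_continuous_within)

lemma has_real_derivative_inner:
  fixes f g :: "real \<Rightarrow> 'a::real_inner"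
  assumes "(f has_vector_derivative f') (at t)" "(g has_vector_derivative g') (at t)"
  shows "((\<lambda>t. f t \<bullet> g t) has_real_derivative f t \<bullet> g' + f' \<bullet> g t) (at t)"
  using bounded_bilinear.has_vector_derivative[OF bounded_bilinear_inner assms]
  by (simp add: has_real_derivative_iff_has_vector_derivative)

text \<open>Squaring removes the kink of the positive part. The resulting cutoff has a continuous
  derivative, as the divergence argument requires.\<close>

lemma has_real_derivative_max0_power2:
  "((\<lambda>s. (max 0 s)\<^sup>2) has_real_derivative 2 * max 0 (s::real)) (at s)"
proof (cases s "0::real" rule: linorder_cases)
  case less
  show ?thesis
    by (rule has_field_derivative_transform_within_open[of "\<lambda>_. 0" _ _ "{..<0}"])
       (use less in auto)
next
  case greater
  show ?thesis
    by (rule has_field_derivative_transform_within_open[of "\<lambda>s. s\<^sup>2" _ _ "{0<..}"])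
       (use greater in \<open>auto intro!: derivative_eq_intros\<close>)
next
  case equal
  have "((\<lambda>h::real. (max 0 h)\<^sup>2 / h) \<longlongrightarrow> 0) (at 0)"
  proof (rule tendsto_0_le[of "\<lambda>h::real. h" _ _ 1])
    show "\<forall>\<^sub>F h::real in at 0. norm ((max 0 h)\<^sup>2 / h) \<le> norm h * 1"
      by (rule always_eventually) (auto simp: max_def power2_eq_square)
  qed (rule tendsto_ident_at)
  then show ?thesis using equal by (simp add: DERIV_def)
qed

text \<open>A hyperplane strictly separates \<open>p\<close> from the hull. A sphere whose center
  \<open>a\<close> lies far from \<open>p\<close>, in the normal direction towards \<open>C\<close>,
  is nearly flat on the bounded set in question and still separates.\<close>

lemma ex_sphere_separating_compact:
  fixes C :: "'a::euclidean_space set"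
  assumes "compact C" "p \<notin> closure (convex hull C)"
  shows "\<exists>a m. m < (p - a) \<bullet> (p - a) \<and> (\<forall>v\<in>C. (v - a) \<bullet> (v - a) < m)"
proof -
  have "convex (closure (convex hull C))" by (simp add: convex_closure)
  from separating_hyperplane_closed_point[OF this closed_closure assms(2)]
  obtain \<xi> b where p: "\<xi> \<bullet> p < b" and b: "\<And>v. v \<in> closure (convex hull C) \<Longrightarrow> b < \<xi> \<bullet> v"
    by auto
  have b': "b < \<xi> \<bullet> v" if "v \<in> C" for v
    using b[OF subsetD[OF closure_subset hull_inc[OF that]]] .
  obtain B where B: "\<And>v. v \<in> C \<Longrightarrow> norm (v - p) \<le> B" "B > 0"
  proof -
    have "bounded ((\<lambda>v. v - p) ` C)"
      by (rule bounded_translation_minus[OF compact_imp_bounded[OF assms(1)]])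
    then show ?thesis using that unfolding bounded_pos by auto
  qed
  define d where "d = b - \<xi> \<bullet> p"
  have "d > 0" using p by (simp add: d_def)
  \<comment> \<open>Seen from \<open>a\<close>, moving from \<open>p\<close> to a point of
    \<open>C\<close> changes the squared distance by at most \<open>B\<^sup>2 - 2 * t * d\<close>.
    This \<open>t\<close> makes that bound \<open>- B\<^sup>2\<close>, and \<open>m\<close> is
    placed halfway.\<close>
  define t where "t = B\<^sup>2 / d"
  have t: "t * d = B\<^sup>2" "t > 0" using \<open>d > 0\<close> B(2) by (auto simp: t_def)
  define a where "a = p + t *\<^sub>R \<xi>"
  define m where "m = (p - a) \<bullet> (p - a) - B\<^sup>2 / 2"
  have "(v - a) \<bullet> (v - a) < m" if "v \<in> C" for v
  proof -
    have "(v - a) \<bullet> (v - a) = (v - p) \<bullet> (v - p) - 2 * t * (\<xi> \<bullet> v - \<xi> \<bullet> p) + (p - a) \<bullet> (p - a)"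
      by (simp add: a_def inner_diff_left inner_diff_right inner_add_left inner_add_right
          inner_commute algebra_simps)
    moreover have "(v - p) \<bullet> (v - p) \<le> B\<^sup>2"
      using power_mono[OF B(1)[OF that], of 2] by (simp add: power2_norm_eq_inner)
    moreover have "t * d \<le> t * (\<xi> \<bullet> v - \<xi> \<bullet> p)"
      using b'[OF that] t(2) unfolding d_def by (intro mult_left_mono) auto
    ultimately have "(v - a) \<bullet> (v - a) \<le> (p - a) \<bullet> (p - a) - B\<^sup>2"
      using t(1) by (simp add: algebra_simps)
    moreover have "B\<^sup>2 > 0" using B(2) by simp
    ultimately show ?thesis unfolding m_def by linarith
  qed
  moreover have "m < (p - a) \<bullet> (p - a)" using B(2) by (simp add: m_def)
  ultimately show ?thesis by blast
qed

section \<open>Vanishing of the gradient on superlevel sets and the convex hull property\<close>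

text \<open>Here \<open>P\<close>, \<open>\<Gamma>\<close>, \<open>N\<close>, \<open>\<Lambda>\<close> are \<open>D\<phi>\<close>, \<open>Dg\<close>, \<open>|D\<phi>|\<^sup>2\<close>, \<open>\<Delta>\<phi>\<close>, and \<open>X = \<chi>(\<phi>) \<psi>(g) D\<phi>\<close> with
  \<open>\<chi>(s) = exp (C s) max(0, s - m)\<^sup>2\<close> and \<open>\<psi>(s) = max(0, s - c)\<^sup>2\<close>. The factor \<open>exp (C s)\<close>
  serves to have \<open>\<chi>' \<ge> C \<chi>\<close>.\<close>

lemma infinity_harmonic_jacobian_zero_on_superlevel:
  fixes u :: "real ^ 'n::finite \<Rightarrow> real ^ 'm::finite" and a :: "real ^ 'm"
  assumes "open G" and harm: "infinity_harmonic_on G u"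
    and cpt: "compact {x\<in>G. m \<le> (u x - a) \<bullet> (u x - a)}"
    and "y \<in> G" "m < (u y - a) \<bullet> (u y - a)"
  shows "jacobian u (at y) = 0"
proof (rule ccontr)
  assume nz: "jacobian u (at y) \<noteq> 0"
  have C1: "C1_on G u" "\<And>i. C1_on G (pderiv_i i u)"
    and L: "\<And>x. x \<in> G \<Longrightarrow> infinity_laplacian u x = 0"
    using harm unfolding infinity_harmonic_on_def C2_on_def by auto
  have cu: "continuous_on G u" "continuous_on G (pderiv_i i u)"
    "continuous_on G (pderiv_i i (pderiv_i j u))" for i j
    using C1_on_imp_continuous_on[OF C1(1)] C1_on_imp_continuous_on[OF C1(2)] C1(2)[unfolded C1_on_def]
    by blast+
  have du: "((\<lambda>t. u (x + t *\<^sub>R axis i 1)) has_vector_derivative pderiv_i i u x) (at 0)"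
    "((\<lambda>t. pderiv_i j u (x + t *\<^sub>R axis i 1)) has_vector_derivative pderiv_i i (pderiv_i j u) x) (at 0)"
    if "x \<in> G" for x i j
    using C1_on_imp_derivative_along_axis that C1 by blast+
  define \<phi> where "\<phi> x = (u x - a) \<bullet> (u x - a)" for x
  define g where "g x = (\<Sum>j\<in>UNIV. pderiv_i j u x \<bullet> pderiv_i j u x)" for x
  define P where "P i x = 2 * ((u x - a) \<bullet> pderiv_i i u x)" for i x
  define H where "H i x = 2 * (pderiv_i i u x \<bullet> pderiv_i i u x + (u x - a) \<bullet> pderiv_i i (pderiv_i i u) x)"
    for i x
  define \<Gamma> where "\<Gamma> i x = 2 * (\<Sum>j\<in>UNIV. pderiv_i j u x \<bullet> pderiv_i i (pderiv_i j u) x)" for i x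
  have g_norm: "g x = (norm (jacobian u (at x)))\<^sup>2" for x
    unfolding g_def norm_jacobian_power2 ..
  have cont: "continuous_on G \<phi>" "continuous_on G g" "continuous_on G (P i)"
    "continuous_on G (H i)" "continuous_on G (\<Gamma> i)" for i
    unfolding \<phi>_def g_def P_def H_def \<Gamma>_def by (intro continuous_intros cu)+
  have d\<phi>: "((\<lambda>t. \<phi> (x + t *\<^sub>R axis i 1)) has_real_derivative P i x) (at 0)"
    and dg: "((\<lambda>t. g (x + t *\<^sub>R axis i 1)) has_real_derivative \<Gamma> i x) (at 0)"
    and dP: "((\<lambda>t. P i (x + t *\<^sub>R axis i 1)) has_real_derivative H i x) (at 0)"
    if x: "x \<in> G" for x i
  proof -
    have ua: "((\<lambda>t. u (x + t *\<^sub>R axis i 1) - a) has_vector_derivative pderiv_i i u x) (at 0)"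
      using has_vector_derivative_diff[OF du(1)[OF x] has_vector_derivative_const] by simp
    show "((\<lambda>t. \<phi> (x + t *\<^sub>R axis i 1)) has_real_derivative P i x) (at 0)"
      using has_real_derivative_inner[OF ua ua] by (simp add: \<phi>_def P_def inner_commute)
    show "((\<lambda>t. P i (x + t *\<^sub>R axis i 1)) has_real_derivative H i x) (at 0)"
      using DERIV_cmult[OF has_real_derivative_inner[OF ua du(2)[OF x]], of 2]
      by (simp add: H_def P_def add.commute)
    have "((\<lambda>t. g (x + t *\<^sub>R axis i 1)) has_real_derivative
      (\<Sum>j\<in>UNIV. pderiv_i j u (x + 0 *\<^sub>R axis i 1) \<bullet> pderiv_i i (pderiv_i j u) x +
         pderiv_i i (pderiv_i j u) x \<bullet> pderiv_i j u (x + 0 *\<^sub>R axis i 1))) (at 0)"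
      unfolding g_def by (intro DERIV_sum has_real_derivative_inner du(2)[OF x])
    then show "((\<lambda>t. g (x + t *\<^sub>R axis i 1)) has_real_derivative \<Gamma> i x) (at 0)"
      by (simp add: \<Gamma>_def inner_commute sum_distrib_left)
  qed
  have orth: "(\<Sum>i\<in>UNIV. \<Gamma> i x * P i x) = 0" if "x \<in> G" for x
  proof -
    have "(\<Sum>i\<in>UNIV. \<Gamma> i x * P i x) = 4 * ((u x - a) \<bullet> (\<Sum>i\<in>UNIV.
        (\<Sum>j\<in>UNIV. pderiv_i j u x \<bullet> pderiv_i i (pderiv_i j u) x) *\<^sub>R pderiv_i i u x))"
      unfolding \<Gamma>_def P_def inner_sum_right sum_distrib_left[of 4] by (intro sum.cong) auto
    then show ?thesis using infinity_laplacian_zero_tangential[OF L[OF that]] by simp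
  qed
  define N where "N x = (\<Sum>i\<in>UNIV. (P i x)\<^sup>2)" for x
  define \<Lambda> where "\<Lambda> x = (\<Sum>i\<in>UNIV. H i x)" for x
  \<comment> \<open>\<open>N x = 0\<close> says that \<open>u x - a\<close> is orthogonal to all
    columns of the gradient matrix. The normal equation then removes the second derivatives from
    \<Lambda>, leaving \<open>2 * g x\<close>.\<close>
  have critical: "\<Lambda> x > 0" if "x \<in> G" "N x = 0" "g x > 0" for x
  proof -
    have "P i x = 0" for i using \<open>N x = 0\<close> unfolding N_def by (simp add: sum_nonneg_eq_0_iff)
    then have "(u x - a) \<bullet> (\<Sum>i\<in>UNIV. pderiv_i i (pderiv_i i u) x) = 0"
      using infinity_laplacian_zero_normal[OF L[OF that(1)], of "u x - a"] that(3) by (simp add: g_norm P_def)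
    moreover have "\<Lambda> x = 2 * g x + 2 * ((u x - a) \<bullet> (\<Sum>i\<in>UNIV. pderiv_i i (pderiv_i i u) x))"
      unfolding \<Lambda>_def H_def g_def inner_sum_right by (simp add: sum_distrib_left[symmetric] sum.distrib)
    ultimately show ?thesis using that(3) by simp
  qed
  \<comment> \<open>Positivity of \<open>c\<close> keeps \<open>Q\<close> below away from the zeros
    of the gradient, so that \<open>critical\<close> applies on \<open>Q\<close>;
    \<open>c < g y\<close> keeps the cutoff positive at \<open>y\<close>.\<close>
  define c where "c = g y / 2"
  have c: "0 < c" "c < g y" using nz by (auto simp: c_def g_norm)
  define K where "K = {x\<in>G. m \<le> \<phi> x}"
  have K: "compact K" "K \<subseteq> G" using cpt unfolding K_def \<phi>_def by auto
  define Q where "Q = K \<inter> g -` {c..}"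
  have QG: "Q \<subseteq> G" using K(2) by (auto simp: Q_def)
  have "closedin (top_of_set K) Q"
    unfolding Q_def
    by (rule continuous_closedin_preimage[OF continuous_on_subset[OF cont(2) K(2)]]) simp
  then have "compact Q" using closedin_compact K(1) by blast
  obtain C where C: "C \<ge> 0" "\<And>x. x \<in> Q \<Longrightarrow> 0 < C * N x + \<Lambda> x"
  proof -
    have "continuous_on G N" "continuous_on G \<Lambda>"
      unfolding N_def \<Lambda>_def by (intro continuous_intros cont)+
    then have "continuous_on Q N" "continuous_on Q \<Lambda>" using QG continuous_on_subset by blast+
    moreover have "0 \<le> N x" for x unfolding N_def by (simp add: sum_nonneg)
    moreover have "0 < \<Lambda> x" if "x \<in> Q" "N x = 0" for x
      using critical[of x] that QG c(1) by (auto simp: Q_def)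
    ultimately show ?thesis
      using ex_dominating_multiple[OF \<open>compact Q\<close>, of N \<Lambda>] that by blast
  qed
  define E where "E x = exp (C * \<phi> x)" for x
  define M where "M x = max 0 (\<phi> x - m)" for x
  define R where "R x = max 0 (g x - c)" for x
  define X where "X i x = E x * (M x)\<^sup>2 * (R x)\<^sup>2 * P i x" for i x
  \<comment> \<open>The factor \<open>E x * (C * (M x)\<^sup>2 + 2 * M x)\<close> is the derivative
    of the cutoff \<chi> at \<open>\<phi> x\<close>, and \<open>2 * R x\<close> that of \<psi> at
    \<open>g x\<close>.\<close>
  define Y where "Y i x = (R x)\<^sup>2 * E x * (C * (M x)\<^sup>2 + 2 * M x) * (P i x)\<^sup>2
      + E x * (M x)\<^sup>2 * 2 * R x * (\<Gamma> i x * P i x) + E x * (M x)\<^sup>2 * (R x)\<^sup>2 * H i x" for i x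
  have contXY: "continuous_on G (X i)" "continuous_on G (Y i)" for i
    unfolding X_def Y_def E_def M_def R_def by (intro continuous_intros cont)+
  have zero: "X i x = 0" "Y i x = 0" if "x \<in> G" "x \<notin> K" for x i
  proof -
    have "M x = 0" using that by (simp add: K_def M_def)
    then show "X i x = 0" "Y i x = 0" by (simp_all add: X_def Y_def)
  qed
  have deriv: "((\<lambda>t. X i (x + t *\<^sub>R axis i 1)) has_real_derivative Y i x) (at 0)" if x: "x \<in> G" for x i
  proof -
    have dM: "((\<lambda>t. (M (x + t *\<^sub>R axis i 1))\<^sup>2) has_real_derivative 2 * M x * P i x) (at 0)"
      unfolding M_def
      by (rule DERIV_cong[OF DERIV_chain2[OF has_real_derivative_max0_power2
            DERIV_diff[OF d\<phi>[OF x] DERIV_const]]]) simp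
    have dR: "((\<lambda>t. (R (x + t *\<^sub>R axis i 1))\<^sup>2) has_real_derivative 2 * R x * \<Gamma> i x) (at 0)"
      unfolding R_def
      by (rule DERIV_cong[OF DERIV_chain2[OF has_real_derivative_max0_power2
            DERIV_diff[OF dg[OF x] DERIV_const]]]) simp
    have dE: "((\<lambda>t. E (x + t *\<^sub>R axis i 1)) has_real_derivative E x * (C * P i x)) (at 0)"
      unfolding E_def by (rule DERIV_cong[OF DERIV_fun_exp[OF DERIV_cmult[OF d\<phi>[OF x]]]]) simp
    show ?thesis
      unfolding X_def Y_def
      by (rule DERIV_cong[OF DERIV_mult[OF DERIV_mult[OF DERIV_mult[OF dE dM] dR] dP[OF x]]])
         (simp add: algebra_simps power2_eq_square)
  qed
  \<comment> \<open>The terms containing \<Gamma> cancel by \<open>orth\<close>. The part of the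
    derivative of \<chi> due to the exponential joins \<Lambda>, giving the expression that the
    choice of \<open>C\<close> makes positive on \<open>Q\<close>.\<close>
  have divergence: "(\<Sum>i\<in>UNIV. Y i x) = (R x)\<^sup>2 * E x * (M x)\<^sup>2 * (C * N x + \<Lambda> x)
      + (R x)\<^sup>2 * E x * (2 * M x) * N x" if "x \<in> G" for x
  proof -
    have "(\<Sum>i\<in>UNIV. Y i x) = (R x)\<^sup>2 * E x * (C * (M x)\<^sup>2 + 2 * M x) * N x
      + E x * (M x)\<^sup>2 * 2 * R x * (\<Sum>i\<in>UNIV. \<Gamma> i x * P i x) + E x * (M x)\<^sup>2 * (R x)\<^sup>2 * \<Lambda> x"
      unfolding Y_def N_def \<Lambda>_def by (simp only: sum.distrib sum_distrib_left)
    then show ?thesis unfolding orth[OF that] by (simp add: algebra_simps)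
  qed
  have rest: "0 \<le> (R x)\<^sup>2 * E x * (2 * M x) * N x" for x
    by (intro mult_nonneg_nonneg) (auto simp: E_def M_def N_def sum_nonneg)
  have nonneg: "0 \<le> (\<Sum>i\<in>UNIV. Y i x)" if "x \<in> G" for x
  proof (cases "x \<in> Q")
    case True
    have "0 \<le> (R x)\<^sup>2 * E x * (M x)\<^sup>2 * (C * N x + \<Lambda> x)"
      using less_imp_le[OF C(2)[OF True]] by (intro mult_nonneg_nonneg[of "_ * _ * _"]) (auto simp: E_def)
    then show ?thesis
      unfolding divergence[OF that] using rest[of x] by (rule add_nonneg_nonneg)
  next
    case False
    \<comment> \<open>Off \<open>Q\<close> one of the two cutoffs is 0, so the sign of
      \<open>C * N x + \<Lambda> x\<close> is irrelevant there.\<close>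
    then have "\<phi> x < m \<or> g x < c" using that unfolding Q_def K_def by auto
    then have "M x = 0 \<or> R x = 0" unfolding M_def R_def by linarith
    then have "(\<Sum>i\<in>UNIV. Y i x) = 0" unfolding divergence[OF that] by (elim disjE) simp_all
    then show ?thesis by simp
  qed
  have "(\<Sum>i\<in>UNIV. Y i y) = 0"
    by (rule divergence_nonneg_compact_support_imp_zero[where X = X and e = "\<lambda>i. axis i 1" and G = G and K = K])
       (use \<open>open G\<close> K contXY deriv zero nonneg \<open>y \<in> G\<close> in auto)
  moreover have "0 < (R y)\<^sup>2 * E y * (M y)\<^sup>2 * (C * N y + \<Lambda> y)"
  proof -
    have "y \<in> Q" using assms(4,5) c(2) by (simp add: Q_def K_def \<phi>_def)
    moreover have "M y > 0" "R y > 0" "E y > 0" using assms(5) c(2) by (auto simp: M_def R_def E_def \<phi>_def)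
    ultimately show ?thesis using C(2)[of y] by simp
  qed
  ultimately show False using divergence[OF assms(4)] rest[of y] by simp
qed

text \<open>The squared positive part of \<open>\<phi> - m\<close>, extended by zero, is
  differentiable along every line. Its derivative is 0, because the gradient of \<open>u\<close>
  vanishes wherever this function is positive. It is therefore constant on a line through
  \<open>y\<close>, yet the line leaves the compact superlevel set.\<close>

lemma infinity_harmonic_superlevel_empty:
  fixes u :: "real ^ 'n::finite \<Rightarrow> real ^ 'm::finite" and a :: "real ^ 'm"
  assumes "open G" and harm: "infinity_harmonic_on G u"
    and cpt: "compact {x\<in>G. m \<le> (u x - a) \<bullet> (u x - a)}"
    and "y \<in> G"
  shows "(u y - a) \<bullet> (u y - a) \<le> m"
proof (rule ccontr)
  assume neg: "\<not> ?thesis"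
  define \<phi> where "\<phi> x = (u x - a) \<bullet> (u x - a)" for x
  have y: "m < \<phi> y" using neg by (simp add: \<phi>_def)
  define K where "K = {x\<in>G. m \<le> \<phi> x}"
  have K: "compact K" "K \<subseteq> G" using cpt unfolding K_def \<phi>_def by auto
  \<comment> \<open>Any one coordinate direction suffices, and index types are nonempty.\<close>
  obtain i :: 'n where True by blast
  define e where "e = (axis i 1 :: real ^ 'n)"
  define f where "f x = (if x \<in> G then (max 0 (\<phi> x - m))\<^sup>2 else 0)" for x
  have d: "((\<lambda>t. f (x + t *\<^sub>R e)) has_real_derivative (if x \<in> G then 0 else 0)) (at 0)" for x
    unfolding f_def
  proof (rule extend_by_zero_derivative_along_line[OF \<open>open G\<close> compact_imp_closed[OF K(1)] K(2)])
    show "(max 0 (\<phi> x - m))\<^sup>2 = 0" if "x \<in> G" "x \<notin> K" for x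
      using that by (simp add: K_def)
    show "((\<lambda>t. (max 0 (\<phi> (x + t *\<^sub>R e) - m))\<^sup>2) has_real_derivative 0) (at 0)" if x: "x \<in> G" for x
    proof -
      have "((\<lambda>t. u (x + t *\<^sub>R e)) has_vector_derivative pderiv_i i u x) (at 0)"
        using harm x C1_on_imp_derivative_along_axis
        unfolding infinity_harmonic_on_def C2_on_def e_def by blast
      from has_vector_derivative_diff[OF this has_vector_derivative_const]
      have ua: "((\<lambda>t. u (x + t *\<^sub>R e) - a) has_vector_derivative pderiv_i i u x) (at 0)"
        by simp
      have "((\<lambda>t. \<phi> (x + t *\<^sub>R e)) has_real_derivative 2 * ((u x - a) \<bullet> pderiv_i i u x)) (at 0)"
        using has_real_derivative_inner[OF ua ua] by (simp add: \<phi>_def inner_commute)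
      from DERIV_chain2[OF has_real_derivative_max0_power2 DERIV_diff[OF this DERIV_const]]
      have "((\<lambda>t. (max 0 (\<phi> (x + t *\<^sub>R e) - m))\<^sup>2) has_real_derivative
          2 * max 0 (\<phi> x - m) * (2 * ((u x - a) \<bullet> pderiv_i i u x))) (at 0)"
        by simp
      moreover have "max 0 (\<phi> x - m) * ((u x - a) \<bullet> pderiv_i i u x) = 0"
      proof (cases "m < \<phi> x")
        case True
        then have "jacobian u (at x) = 0"
          using infinity_harmonic_jacobian_zero_on_superlevel[OF \<open>open G\<close> harm cpt x]
          by (simp add: \<phi>_def)
        then have "pderiv_i i u x = 0"
          using jacobian_nth[of u x _ i] by (simp add: vec_eq_iff)
        then show ?thesis by simp
      qed simp
      ultimately show ?thesis by (simp add: mult.assoc mult.left_commute)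
    qed
  qed
  have "((\<lambda>t. f (y + t *\<^sub>R e)) has_real_derivative 0) (at s)" for s
    using has_derivative_along_line_shift[where f = f and f' = "\<lambda>_. 0"] d by simp
  then have const: "f (y + t *\<^sub>R e) = f (y + 0 *\<^sub>R e)" for t
    by (intro DERIV_isconst_all) auto
  obtain B where B: "\<And>x. x \<in> K \<Longrightarrow> norm x \<le> B"
    using compact_imp_bounded[OF K(1)] unfolding bounded_iff by blast
  \<comment> \<open>Large enough that \<open>y + t *\<^sub>R e\<close> has norm at least
    \<open>\<bar>B\<bar> + 1\<close>.\<close>
  define t where "t = \<bar>B\<bar> + norm y + 1"
  have "t = norm (t *\<^sub>R e)" by (simp add: e_def t_def)
  also have "\<dots> \<le> norm (y + t *\<^sub>R e) + norm y"
    using norm_triangle_ineq4[of "y + t *\<^sub>R e" y] by simp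
  finally have "y + t *\<^sub>R e \<notin> K" using B[of "y + t *\<^sub>R e"] by (auto simp: t_def)
  then have "f (y + t *\<^sub>R e) = 0" by (auto simp: f_def K_def max_def)
  then show False using const[of t] y \<open>y \<in> G\<close> by (simp add: f_def)
qed

text \<open>If \<open>u y\<close> were outside the hull, a sphere would separate it from the values
  on the frontier. The superlevel set of the squared distance to the center then avoids the
  frontier, so it is compact inside \<open>interior \<Omega>'\<close>, where the previous lemma
  gives a contradiction.\<close>

lemma infinity_harmonic_convex_hull_property:
  fixes u :: "real ^ 'n::finite \<Rightarrow> real ^ 'm::finite"
  assumes harm: "infinity_harmonic_on \<Omega> u"
    and cpt: "compact (closure \<Omega>')" and sub: "closure \<Omega>' \<subseteq> \<Omega>"
  shows "u ` \<Omega>' \<subseteq> closure (convex hull (u ` frontier \<Omega>'))"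
proof (rule image_subsetI, rule ccontr)
  fix y assume y: "y \<in> \<Omega>'" "u y \<notin> closure (convex hull (u ` frontier \<Omega>'))"
  have cu: "continuous_on (closure \<Omega>') u"
    using harm sub C1_on_imp_continuous_on continuous_on_subset
    unfolding infinity_harmonic_on_def C2_on_def by blast
  have fr: "frontier \<Omega>' \<subseteq> closure \<Omega>'" by (simp add: frontier_def)
  have "compact (frontier \<Omega>')"
    using compact_Int_closed[OF cpt frontier_closed, of \<Omega>'] fr by (simp add: Int_absorb1)
  then have "compact (u ` frontier \<Omega>')"
    by (rule compact_continuous_image[OF continuous_on_subset[OF cu fr]])
  from ex_sphere_separating_compact[OF this y(2)] obtain a m
    where m: "m < (u y - a) \<bullet> (u y - a)"
      and fm: "\<And>x. x \<in> frontier \<Omega>' \<Longrightarrow> (u x - a) \<bullet> (u x - a) < m"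
    by blast
  have int: "x \<in> interior \<Omega>'" if "x \<in> closure \<Omega>'" "m \<le> (u x - a) \<bullet> (u x - a)" for x
    using that fm[of x] by (auto simp: frontier_def)
  have eq: "{x \<in> interior \<Omega>'. m \<le> (u x - a) \<bullet> (u x - a)}
      = closure \<Omega>' \<inter> (\<lambda>x. (u x - a) \<bullet> (u x - a)) -` {m..}"
    using int subsetD[OF interior_subset] subsetD[OF closure_subset] unfolding vimage_def by blast
  have "closedin (top_of_set (closure \<Omega>'))
      (closure \<Omega>' \<inter> (\<lambda>x. (u x - a) \<bullet> (u x - a)) -` {m..})"
    by (intro continuous_closedin_preimage continuous_intros cu)
  from closedin_compact[OF cpt this]
  have K: "compact {x \<in> interior \<Omega>'. m \<le> (u x - a) \<bullet> (u x - a)}"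
    unfolding eq .
  have "interior \<Omega>' \<subseteq> \<Omega>" using sub interior_subset[of \<Omega>'] closure_subset[of \<Omega>'] by blast
  then have harm': "infinity_harmonic_on (interior \<Omega>') u"
    using harm unfolding infinity_harmonic_on_def C2_on_def C1_on_def
    by (blast intro: continuous_on_subset)
  have "y \<in> interior \<Omega>'" using int[OF subsetD[OF closure_subset y(1)]] m by simp
  from infinity_harmonic_superlevel_empty[OF open_interior harm' K this] m
  show False by simp
qed

theorem corollary1p3:
  fixes \<Omega> :: "(real ^ 2) set" and u :: "real ^ 2 \<Rightarrow> real ^ 2"
  assumes "open \<Omega>"
    and "infinity_harmonic_on \<Omega> u"
  shows "\<forall>\<Omega>'. compact (closure \<Omega>') \<and> closure \<Omega>' \<subseteq> \<Omega> \<longrightarrow>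
           u ` \<Omega>' \<subseteq> closure (convex hull (u ` frontier \<Omega>'))"
  using infinity_harmonic_convex_hull_property[OF assms(2)] by blast

end
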